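(* For every $\varepsilon>0$ there is a constant $C_\varepsilon>0$ such that for every positive integer $N$, every interval $I\subset[0,1]$ and every Sidon set $S\subset[N]$ with $|S|\geq \frac{1}{100}N^{1/2}$, $$\left|\mathbb{E}_{x\in S}1_I(x/N)-\mathrm{meas}(I)\right|\leq C_\varepsilon N^{\varepsilon}\left(\left|\frac{|S|}{N^{1/2}}-1\right|+N^{-1/6}\right)^{1/2}.$$
   Context: $[N]=\{1,2,\dots,N\}$. A set $S\subset\mathbb{Z}$ is Sidon if every non-zero integer $x$ has at most one representation $x=s_1-s_2$ with $s_1,s_2\in S$. For a finite non-empty set $S$, $\mathbb{E}_{x\in S}f(x)=\frac{1}{|S|}\sum_{x\in S}f(x)$. $\mathrm{meas}(I)$ is the Lebesgue measure (length) of $I$, and $1_A$ is the indicator function of $A$. *)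

theory Defs
  imports "HOL-Analysis.Analysis"
begin

definition sidon :: "int set \<Rightarrow> bool" where
  "sidon S \<longleftrightarrow>
     (\<forall>x. x \<noteq> 0 \<longrightarrow> (\<exists>\<^sub>\<le>\<^sub>1 p. p \<in> S \<times> S \<and> x = fst p - snd p))"

text \<open>Meaningful for finite nonempty \<open>S\<close>; the value is 0 otherwise.\<close>

definition average :: "'a set \<Rightarrow> ('a \<Rightarrow> real) \<Rightarrow> real" where
  "average S f = (1 / real (card S)) * (\<Sum>x\<in>S. f x)"

end

theory Submission
  imports Defs
begin

(* Slide a window of length u, about N^(3/4), across [N]. Since nonzero differences are
   represented at most once, the window counts have second moment at most u |S| + u^2, which is
   close to the square of their mean when |S| is close to N^(1/2). Hence their variance is small,
   and Cauchy-Schwarz over the windows meeting an interval bounds the number of elements of S in it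
   from above. The lower bound is the upper bound for the two complementary intervals, which avoids
   counting elements near the endpoints. This gives the error (| |S|/N^(1/2) - 1 | + N^(-1/4))^(1/2)
   with an absolute constant, so the factor N^eps is only estimated below by 1. *)

section \<open>Window counts and their first moment\<close>

text \<open>The window is (x - u, x], indexed by its right end. A sum of indicators, rather than a
  cardinality, lets both moments be computed by exchanging sums.\<close>

definition window :: "int set \<Rightarrow> int \<Rightarrow> int \<Rightarrow> real" where
  "window S u x = (\<Sum>s\<in>S. of_bool (s \<le> x \<and> x < s + u))"

lemma sum_of_bool_interval:
  fixes c d a b :: int
  assumes "a \<le> c" "d \<le> b + 1" "c \<le> d"
  shows "(\<Sum>x\<in>{a..b}. of_bool (c \<le> x \<and> x < d)) = real_of_int (d - c)"
proof -
  have "(\<Sum>x\<in>{a..b}. of_bool (c \<le> x \<and> x < d)) = (\<Sum>x\<in>{c..<d}. 1::real)"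
    by (rule sum.mono_neutral_cong_right) (use assms in auto)
  then show ?thesis
    using assms by simp
qed

text \<open>Right ends in \<open>{1..n+u}\<close> account for every window that meets
  \<open>{1..n}\<close>, so each element of \<open>S\<close> is counted exactly \<open>u\<close>
  times.\<close>

lemma sum_window:
  assumes "S \<subseteq> {1..n}" "u \<ge> 0"
  shows "(\<Sum>x\<in>{1..n+u}. window S u x) = real_of_int u * card S"
proof -
  have "(\<Sum>x\<in>{1..n+u}. window S u x)
      = (\<Sum>s\<in>S. \<Sum>x\<in>{1..n+u}. of_bool (s \<le> x \<and> x < s + u))"
    unfolding window_def by (rule sum.swap)
  also have "\<dots> = (\<Sum>s\<in>S. real_of_int u)"
  proof (rule sum.cong)
    fix s assume "s \<in> S"
    then show "(\<Sum>x\<in>{1..n+u}. of_bool (s \<le> x \<and> x < s + u)) = real_of_int u"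
      using sum_of_bool_interval[of 1 s "s+u" "n+u"] assms by auto
  qed simp
  finally show ?thesis by simp
qed

text \<open>Passing from \<open>n\<close> to \<open>n + 1\<close> raises each of the 2n + 1 old
  terms by 1, and the two new end terms vanish. This evaluates the total overlap over all possible
  differences.\<close>

lemma sum_tent: "(\<Sum>d\<in>{-int n..int n}. real n - \<bar>real_of_int d\<bar>) = (real n)\<^sup>2"
proof (induction n)
  case (Suc n)
  have eq: "{-int (Suc n)..int (Suc n)} = insert (-int (Suc n)) (insert (int (Suc n)) {-int n..int n})"
    by auto
  have "(\<Sum>d\<in>{-int (Suc n)..int (Suc n)}. real (Suc n) - \<bar>real_of_int d\<bar>)
      = (\<Sum>d\<in>{-int n..int n}. (real n - \<bar>real_of_int d\<bar>) + 1)"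
    unfolding eq by (simp add: algebra_simps)
  also have "\<dots> = (real n)\<^sup>2 + (2 * real n + 1)"
    unfolding sum.distrib Suc.IH by (simp add: nat_add_distrib)
  finally show ?case
    by (simp add: power2_eq_square algebra_simps)
qed simp

section \<open>Consequences of the Sidon property: second moment and size\<close>

text \<open>This form lets off-diagonal pairs be replaced by their differences, both when summing
  and when counting.\<close>

lemma sidon_inj_on_diff:
  assumes "sidon S"
  shows "inj_on (\<lambda>p. fst p - snd p) {p \<in> S \<times> S. fst p \<noteq> snd p}"
proof (rule inj_onI)
  fix p q
  assume p: "p \<in> {p \<in> S \<times> S. fst p \<noteq> snd p}" and q: "q \<in> {p \<in> S \<times> S. fst p \<noteq> snd p}"
    and eq: "fst p - snd p = fst q - snd q"
  have "fst p - snd p \<noteq> 0" using p by auto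
  then have "\<exists>\<^sub>\<le>\<^sub>1 r. r \<in> S \<times> S \<and> fst p - snd p = fst r - snd r"
    using assms unfolding sidon_def by blast
  then show "p = q"
    using p q eq unfolding Uniq_def by blast
qed

text \<open>Expanding the square counts, for each pair from \<open>S\<close>, the windows containing
  both elements. The diagonal gives \<open>u * card S\<close>. Off the diagonal each difference
  occurs at most once, so the sum is at most the whole tent sum.\<close>

lemma sum_window_square_le:
  assumes S: "S \<subseteq> {1..n}" and u: "u \<ge> 0" and sid: "sidon S"
  shows "(\<Sum>x\<in>{1..n+u}. (window S u x)\<^sup>2) \<le> real_of_int u * card S + (real_of_int u)\<^sup>2"
proof -
  have fin: "finite S" using S finite_subset by blast
  define g where "g d = max 0 (real_of_int u - \<bar>real_of_int d\<bar>)" for d :: int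
  define P where "P = {p \<in> S \<times> S. fst p \<noteq> snd p}"
  have finP: "finite P" unfolding P_def using fin by simp
  have overlap: "(\<Sum>x\<in>{1..n+u}. of_bool (s \<le> x \<and> x < s + u) * of_bool (t \<le> x \<and> x < t + u)) = g (s - t)"
    if "s \<in> S" "t \<in> S" for s t
  proof -
    have st: "1 \<le> s" "s \<le> n" "1 \<le> t" "t \<le> n" using that S by auto
    \<comment> \<open>The outer \<open>max\<close> makes the interval empty instead of reversed when
      s and t are at least u apart, matching the truncation at 0 in \<open>g\<close>.\<close>
    have "(\<Sum>x\<in>{1..n+u}. of_bool (s \<le> x \<and> x < s + u) * of_bool (t \<le> x \<and> x < t + u))
        = (\<Sum>x\<in>{1..n+u}. (of_bool (max s t \<le> x \<and> x < max (max s t) (min s t + u)) :: real))"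
      by (rule sum.cong) auto
    also have "\<dots> = real_of_int (max (max s t) (min s t + u) - max s t)"
      by (rule sum_of_bool_interval) (use st u in auto)
    also have "\<dots> = g (s - t)" unfolding g_def by (auto simp: max_def min_def abs_if)
    finally show ?thesis .
  qed
  have "(\<Sum>x\<in>{1..n+u}. (window S u x)\<^sup>2)
      = (\<Sum>x\<in>{1..n+u}. \<Sum>p\<in>S\<times>S. of_bool (fst p \<le> x \<and> x < fst p + u) * of_bool (snd p \<le> x \<and> x < snd p + u))"
    unfolding window_def power2_eq_square sum_product sum.cartesian_product
    by (simp add: case_prod_unfold)
  also have "\<dots> = (\<Sum>p\<in>S\<times>S. \<Sum>x\<in>{1..n+u}. of_bool (fst p \<le> x \<and> x < fst p + u) * of_bool (snd p \<le> x \<and> x < snd p + u))"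
    by (rule sum.swap)
  also have "\<dots> = (\<Sum>p\<in>S\<times>S. g (fst p - snd p))"
    by (rule sum.cong[OF refl], rule overlap) auto
  also have "\<dots> = (\<Sum>p\<in>(\<lambda>s. (s, s)) ` S. g (fst p - snd p)) + (\<Sum>p\<in>P. g (fst p - snd p))"
  proof -
    have "S \<times> S = (\<lambda>s. (s, s)) ` S \<union> P" "(\<lambda>s. (s, s)) ` S \<inter> P = {}"
      unfolding P_def by auto
    then show ?thesis using fin finP by (simp add: sum.union_disjoint)
  qed
  also have "(\<Sum>p\<in>(\<lambda>s. (s, s)) ` S. g (fst p - snd p)) = real_of_int u * card S"
    using u by (subst sum.reindex) (auto simp: inj_on_def g_def)
  also have "(\<Sum>p\<in>P. g (fst p - snd p)) = (\<Sum>d\<in>(\<lambda>p. fst p - snd p) ` P. g d)"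
    using sidon_inj_on_diff[OF sid] unfolding P_def by (simp add: sum.reindex)
  \<comment> \<open>Differences can exceed u in size, so \<open>{-u..u}\<close> is adjoined first,
    using \<open>g\<close> nonnegative; the differences outside it are then discarded because
    \<open>g\<close> vanishes there.\<close>
  also have "\<dots> \<le> (\<Sum>d\<in>((\<lambda>p. fst p - snd p) ` P) \<union> {-u..u}. g d)"
    by (rule sum_mono2) (use finP in \<open>auto simp: g_def\<close>)
  also have "\<dots> = (\<Sum>d\<in>{-u..u}. real_of_int u - \<bar>real_of_int d\<bar>)"
    by (rule sum.mono_neutral_cong_right) (use finP in \<open>auto simp: g_def\<close>)
  also have "\<dots> = (real_of_int u)\<^sup>2"
    using sum_tent[of "nat u"] u by simp
  finally show ?thesis by simp
qed

text \<open>The off-diagonal pairs have distinct nonzero differences in [-N, N], and the diagonal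
  adds at most N pairs, so |S|^2 is at most 3N. The crude constant suffices, since the bound only
  serves to estimate |S|/u.\<close>

lemma sidon_card_le:
  assumes S: "S \<subseteq> {1..int N}" and sid: "sidon S"
  shows "real (card S) \<le> 2 * sqrt (real N)"
proof -
  have fin: "finite S" using S finite_subset by blast
  have "card S \<le> card {1..int N}" by (rule card_mono) (use S in auto)
  then have cN: "card S \<le> N" by simp
  define P where "P = {p \<in> S \<times> S. fst p \<noteq> snd p}"
  have "(\<lambda>p. fst p - snd p) ` P \<subseteq> {-int N..int N} - {0}"
  proof (intro image_subsetI)
    fix p assume "p \<in> P"
    then have "fst p \<in> {1..int N}" "snd p \<in> {1..int N}" "fst p \<noteq> snd p"
      unfolding P_def using S by auto
    then show "fst p - snd p \<in> {-int N..int N} - {0}" by auto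
  qed
  then have "card ((\<lambda>p. fst p - snd p) ` P) \<le> card ({-int N..int N} - {0})"
    by (rule card_mono[rotated]) simp
  then have cP: "card P \<le> 2 * N"
    using sidon_inj_on_diff[OF sid] unfolding P_def by (simp add: card_image)
  have "S \<times> S = (\<lambda>s. (s, s)) ` S \<union> P" unfolding P_def by auto
  then have "card (S \<times> S) \<le> card ((\<lambda>s. (s, s)) ` S) + card P" by (metis card_Un_le)
  also have "\<dots> \<le> N + 2 * N" using card_image_le[OF fin, of "\<lambda>s. (s, s)"] cN cP by linarith
  finally have "card S * card S \<le> 4 * N" by (simp add: card_cartesian_product)
  then have "(real (card S))\<^sup>2 \<le> (2 * sqrt (real N))\<^sup>2"
    by (simp add: power2_eq_square flip: of_nat_mult)
  then show ?thesis by (rule power2_le_imp_le) simp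
qed

section \<open>From the variance of window counts to counts in integer intervals\<close>

text \<open>The subtracted value is the mean over the n + u windows, so the sum is the second moment
  minus (n + u) times the squared mean.\<close>

lemma sum_window_variance_le:
  fixes n u :: int
  assumes S: "S \<subseteq> {1..n}" and u: "u \<ge> 0" and n: "n > 0" and sid: "sidon S"
  shows "(\<Sum>x\<in>{1..n+u}. (window S u x - u * card S / (n + u))\<^sup>2)
    \<le> u * card S + (real_of_int u)\<^sup>2 * (1 - (real (card S))\<^sup>2 / (n + u))"
proof -
  define m where "m = u * card S / (n + u)"
  have m: "(n + u) * m = u * card S" unfolding m_def using n u by simp
  have "(\<Sum>x\<in>{1..n+u}. (window S u x - m)\<^sup>2)
      = (\<Sum>x\<in>{1..n+u}. (window S u x)\<^sup>2) - 2 * m * (\<Sum>x\<in>{1..n+u}. window S u x) + (n + u) * m\<^sup>2"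
    using n u by (simp add: power2_diff sum.distrib sum_subtractf sum_distrib_left algebra_simps)
  also have "\<dots> = (\<Sum>x\<in>{1..n+u}. (window S u x)\<^sup>2) - (real_of_int u)\<^sup>2 * ((real (card S))\<^sup>2 / (n + u))"
  proof -
    have "2 * m * (u * card S) - (n + u) * m\<^sup>2 = m * (u * card S)"
      unfolding m[symmetric] by (simp add: power2_eq_square algebra_simps)
    also have "\<dots> = (real_of_int u)\<^sup>2 * ((real (card S))\<^sup>2 / (n + u))"
      unfolding m_def by (simp add: power2_eq_square)
    finally show ?thesis unfolding sum_window[OF S u] by simp
  qed
  finally show ?thesis
    using sum_window_square_le[OF S u sid] unfolding m_def by (simp add: algebra_simps)
qed

text \<open>All u windows containing a given element of \<open>{a..b}\<close> have right ends in
  \<open>{a..b+u}\<close>. Elements outside \<open>{a..b}\<close> only add to the right-hand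
  side.\<close>

lemma window_upper:
  fixes n u a b :: int
  assumes S: "S \<subseteq> {1..n}" and u: "u \<ge> 0"
  shows "u * card (S \<inter> {a..b}) \<le> (\<Sum>x\<in>{a..b+u}. window S u x)"
proof -
  have fin: "finite S" using S finite_subset by blast
  have "u * card (S \<inter> {a..b}) = (\<Sum>s\<in>S \<inter> {a..b}. \<Sum>x\<in>{a..b+u}. (of_bool (s \<le> x \<and> x < s + u) :: real))"
    using u by (subst sum.cong[OF refl sum_of_bool_interval]) auto
  also have "\<dots> \<le> (\<Sum>s\<in>S. \<Sum>x\<in>{a..b+u}. of_bool (s \<le> x \<and> x < s + u))"
    by (rule sum_mono2) (use fin in \<open>auto intro!: sum_nonneg\<close>)
  also have "\<dots> = (\<Sum>x\<in>{a..b+u}. window S u x)"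
    unfolding window_def by (rule sum.swap)
  finally show ?thesis by simp
qed

lemma sidon_interval_card_le:
  fixes n u a b :: int
  assumes S: "S \<subseteq> {1..n}" and u: "u > 0" and n: "n > 0" and sid: "sidon S"
    and ab: "1 \<le> a" "b \<le> n" "a \<le> b + 1"
  shows "card (S \<inter> {a..b}) \<le> (b - a + 1 + u) * card S / (n + u)
    + sqrt ((n + u) * (card S / u + (1 - (real (card S))\<^sup>2 / (n + u))))"
proof -
  define m where "m = u * card S / (n + u)"
  let ?X = "{a..b+u}"
  let ?R = "sqrt ((n + u) * (card S / u + (1 - (real (card S))\<^sup>2 / (n + u))))"
  let ?V = "u * card S + (real_of_int u)\<^sup>2 * (1 - (real (card S))\<^sup>2 / (n + u))"
  have cX: "real (card ?X) = b - a + 1 + u" using u ab by simp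
  have "(\<Sum>x\<in>?X. (window S u x - m)\<^sup>2) \<le> (\<Sum>x\<in>{1..n+u}. (window S u x - m)\<^sup>2)"
    by (rule sum_mono2) (use ab in auto)
  also have "\<dots> \<le> ?V"
    using sum_window_variance_le[OF S _ n sid] u unfolding m_def by simp
  finally have V: "(\<Sum>x\<in>?X. (window S u x - m)\<^sup>2) \<le> ?V" .
  have V0: "?V \<ge> 0" by (rule order_trans[OF _ V]) (simp add: sum_nonneg)
  \<comment> \<open>Cauchy-Schwarz against the constant 1. The number of windows is then bounded by
    n + u, so the error does not depend on the interval.\<close>
  have "(\<Sum>x\<in>?X. window S u x - m)\<^sup>2 \<le> card ?X * (\<Sum>x\<in>?X. (window S u x - m)\<^sup>2)"
    using Cauchy_Schwarz_ineq_sum[of "\<lambda>_. 1" "\<lambda>x. window S u x - m" ?X] by simp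
  also have "\<dots> \<le> (n + u) * ?V"
    by (rule mult_mono) (use V V0 cX ab u n in \<open>auto simp: sum_nonneg\<close>)
  also have "\<dots> = (real_of_int u)\<^sup>2 * ((n + u) * (card S / u + (1 - (real (card S))\<^sup>2 / (n + u))))"
  proof -
    have "u * c + (real_of_int u)\<^sup>2 * q = (real_of_int u)\<^sup>2 * (c / u + q)" for c q :: real
      using u by (simp add: field_simps power2_eq_square)
    then show ?thesis by (simp only: mult.left_commute of_int_mult of_int_of_nat_eq)
  qed
  finally have "(\<Sum>x\<in>?X. window S u x - m) \<le> u * ?R"
    using u by (metis real_le_rsqrt real_sqrt_mult real_sqrt_abs abs_of_nonneg of_int_nonneg less_imp_le)
  then have 1: "(\<Sum>x\<in>?X. window S u x) \<le> (b - a + 1 + u) * m + u * ?R"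
    unfolding sum_subtractf sum_constant cX by simp
  have "u * card (S \<inter> {a..b}) \<le> (\<Sum>x\<in>?X. window S u x)"
    using window_upper[OF S] u by simp
  also note 1
  also have "(b - a + 1 + u) * m + u * ?R = u * ((b - a + 1 + u) * card S / (n + u) + ?R)"
    unfolding m_def by (simp add: algebra_simps)
  finally show ?thesis
    using u by simp
qed

section \<open>Choice of window length and rescaling to [0,1]\<close>

lemma sidon_real_interval_card_le:
  fixes \<alpha> \<beta> :: real
  assumes N: "N > 0" and S: "S \<subseteq> {1..int N}" and sid: "sidon S"
    and large: "real (card S) \<ge> 1 / 100 * sqrt (real N)"
    and \<alpha>\<beta>: "0 \<le> \<alpha>" "\<alpha> \<le> \<beta>" "\<beta> \<le> 1"
    and R_def: "R = \<bar>real (card S) / sqrt (real N) - 1\<bar> + real N powr (- 1 / 6)"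
  shows "card {s \<in> S. \<alpha> \<le> s / N \<and> s / N \<le> \<beta>} \<le> card S * (\<beta> - \<alpha> + 400 * sqrt R)"
proof -
  define \<delta> where "\<delta> = real (card S) / sqrt (real N) - 1"
  \<comment> \<open>This exponent balances the diagonal term |S|/u against the edge loss u/N: both
    are at most 2 N^(-1/4).\<close>
  define u where "u = \<lceil>real N powr (3/4)\<rceil>"
  have N1: "real N \<ge> 1" using N by simp
  have pos: "sqrt (real N) > 0" using N by simp
  have p1: "real N powr (3/4) \<ge> 1" using N1 by (simp add: ge_one_powr_ge_zero)
  have u0: "u > 0" and ulo: "real N powr (3/4) \<le> u" and uhi: "u \<le> 2 * real N powr (3/4)"
    unfolding u_def using p1 by linarith+
  have uN: "u \<le> int N"
  proof -
    have "real N powr (3/4) \<le> real N powr 1" using N1 by (intro powr_mono) auto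
    then show ?thesis unfolding u_def by (simp add: ceiling_le_iff)
  qed
  have R0: "R \<ge> 0" unfolding R_def by simp
  have R16: "real N powr (-1/6) \<le> R" unfolding R_def by simp
  have Nq: "real N powr (-1/4) \<le> R"
    using powr_mono[of "-1/4" "-1/6" "real N"] N1 R16 by simp
  \<comment> \<open>The edge terms 1/N and u/N appear outside the square root of the variance bound,
    so they must be compared with \<open>sqrt R\<close> rather than \<open>R\<close>.\<close>
  have Nsq: "real N powr (-1/4) \<le> sqrt R"
  proof -
    have "real N powr (-1/4) \<le> real N powr (-1/12)" using N1 by (intro powr_mono) auto
    also have "\<dots> = sqrt (real N powr (-1/6))"
      by (simp add: powr_half_sqrt[symmetric] powr_powr)
    also have "\<dots> \<le> sqrt R" using R16 by simp
    finally show ?thesis .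
  qed
  have inv: "1 / real N \<le> sqrt R"
  proof -
    have "real N powr (-1) \<le> real N powr (-1/4)" using N1 by (intro powr_mono) auto
    then show ?thesis using Nsq N by (simp add: powr_minus_divide)
  qed
  have uNq: "u / N \<le> 2 * real N powr (-1/4)"
  proof -
    have "u / N \<le> 2 * real N powr (3/4) / N" using uhi N by (simp add: divide_right_mono)
    also have "\<dots> = 2 * real N powr (3/4 - 1)" using N by (simp only: powr_diff) simp
    finally show ?thesis by simp
  qed
  have cu: "card S / u \<le> 2 * real N powr (-1/4)"
  proof -
    have "card S / u \<le> (2 * sqrt (real N)) / real N powr (3/4)"
      by (rule frac_le) (use sidon_card_le[OF S sid] ulo N in auto)
    also have "\<dots> = 2 * real N powr (1/2 - 3/4)"
      by (simp only: powr_diff) (simp add: powr_half_sqrt)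
    finally show ?thesis by simp
  qed
  have cS: "real (card S) = (1 + \<delta>) * sqrt (real N)"
    unfolding \<delta>_def using pos by (simp add: field_simps)
  have var: "1 - (real (card S))\<^sup>2 / (int N + u) \<le> u / N + 2 * \<bar>\<delta>\<bar>"
  proof -
    have "1 - (real (card S))\<^sup>2 / (int N + u) = (N + u - (real (card S))\<^sup>2) / (N + u)"
      using N u0 by (simp add: field_simps)
    also have "\<dots> \<le> (u + 2 * \<bar>\<delta>\<bar> * N) / (N + u)"
    proof (rule divide_right_mono)
      have "(real (card S))\<^sup>2 = N + 2 * \<delta> * N + \<delta>\<^sup>2 * N"
        unfolding cS power_mult_distrib by (simp add: power2_eq_square algebra_simps)
      moreover have "- (2 * \<bar>\<delta>\<bar> * N) \<le> 2 * \<delta> * N" "\<delta>\<^sup>2 * N \<ge> 0"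
        using mult_right_mono[of "-\<bar>\<delta>\<bar>" \<delta> "real N"] by auto
      ultimately show "N + u - (real (card S))\<^sup>2 \<le> u + 2 * \<bar>\<delta>\<bar> * N" by linarith
    qed (use u0 in auto)
    also have "\<dots> \<le> (u + 2 * \<bar>\<delta>\<bar> * N) / N"
      by (rule divide_left_mono) (use u0 N in auto)
    also have "\<dots> = u / N + 2 * \<bar>\<delta>\<bar>" using N by (simp add: field_simps)
    finally show ?thesis .
  qed
  have sqrt_bd: "sqrt ((int N + u) * (card S / u + (1 - (real (card S))\<^sup>2 / (int N + u)))) \<le> 300 * card S * sqrt R"
  proof -
    have R4: "card S / u + (1 - (real (card S))\<^sup>2 / (int N + u)) \<le> 4 * R"
    proof -
      have "2 * real N powr (-1/4) \<le> 2 * real N powr (-1/6)"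
        using powr_mono[of "-1/4" "-1/6" "real N"] N1 by simp
      then show ?thesis
        using cu var uNq abs_ge_zero[of \<delta>] unfolding R_def \<delta>_def[symmetric] distrib_left
        by linarith
    qed
    have "(int N + u) * (card S / u + (1 - (real (card S))\<^sup>2 / (int N + u))) \<le> (int N + u) * (4 * R)"
      by (rule mult_left_mono[OF R4]) (use u0 in auto)
    also have "\<dots> \<le> (2 * N) * (4 * R)"
      by (rule mult_right_mono) (use uN R0 in auto)
    \<comment> \<open>The constant 8 is rounded up to a perfect square.\<close>
    also have "\<dots> \<le> 9 * N * R" using R0 by (simp add: mult_right_mono)
    finally have "sqrt ((int N + u) * (card S / u + (1 - (real (card S))\<^sup>2 / (int N + u)))) \<le> sqrt (9 * N * R)"
      by (rule real_sqrt_le_mono)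
    also have "\<dots> = 3 * sqrt N * sqrt R" using real_sqrt_mult[of 9] real_sqrt_abs[of 3] by (simp add: real_sqrt_mult)
    \<comment> \<open>The density assumption \<open>large\<close> gives sqrt N at most 100 |S|; it
      turns the error into a multiple of |S|.\<close>
    also have "\<dots> \<le> (300 * card S) * sqrt R"
      by (rule mult_right_mono) (use large R0 in auto)
    finally show ?thesis .
  qed
  \<comment> \<open>The \<open>max\<close> matters when \<alpha> = 0, since the interval bound
    requires a to be at least 1. If no integer fits, then a = b + 1, which that bound still
    allows.\<close>
  define a where "a = max 1 \<lceil>\<alpha> * N\<rceil>"
  define b where "b = \<lfloor>\<beta> * N\<rfloor>"
  have le: "\<alpha> * N \<le> \<beta> * N" using \<alpha>\<beta> by (simp add: mult_right_mono)
  have "\<beta> * N \<le> N" using \<alpha>\<beta> mult_right_mono[of \<beta> 1 "real N"] by simp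
  then have bN: "b \<le> int N" unfolding b_def by linarith
  have nn: "0 \<le> \<beta> * N" "0 \<le> \<alpha> * N" using \<alpha>\<beta> by auto
  have ab: "a \<le> b + 1" unfolding a_def b_def using le nn by linarith
  have len: "b - a + 1 \<le> (\<beta> - \<alpha>) * N + 1"
    unfolding a_def b_def left_diff_distrib using le nn by linarith
  have sub: "{s \<in> S. \<alpha> \<le> s / N \<and> s / N \<le> \<beta>} \<subseteq> S \<inter> {a..b}"
    unfolding a_def b_def using S N by (auto simp: field_simps le_floor_iff ceiling_le_iff)
  have finS: "finite S" using S finite_subset by blast
  have "real (card {s \<in> S. \<alpha> \<le> s / N \<and> s / N \<le> \<beta>}) \<le> card (S \<inter> {a..b})"
    using card_mono[OF _ sub] finS by simp
  also have "\<dots> \<le> (b - a + 1 + u) * card S / (int N + u)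
    + sqrt ((int N + u) * (card S / u + (1 - (real (card S))\<^sup>2 / (int N + u))))"
    using sidon_interval_card_le[OF S u0 _ sid _ bN ab] N unfolding a_def by simp
  \<comment> \<open>The 3 collects 1/N, at most \<open>sqrt R\<close>, and u/N, at most
    \<open>2 * sqrt R\<close>.\<close>
  also have "\<dots> \<le> card S * (\<beta> - \<alpha> + 3 * sqrt R) + 300 * card S * sqrt R"
  proof (rule add_mono[OF _ sqrt_bd])
    have "(b - a + 1 + u) * card S / (int N + u) \<le> (b - a + 1 + u) * card S / N"
      by (rule divide_left_mono) (use u0 N ab in auto)
    also have "\<dots> \<le> ((\<beta> - \<alpha>) * N + 1 + u) * card S / N"
      by (rule divide_right_mono) (use len in \<open>auto intro!: mult_right_mono\<close>)
    also have "\<dots> = card S * ((\<beta> - \<alpha>) + 1 / N + u / N)"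
      using N by (simp add: field_simps)
    also have "\<dots> \<le> card S * (\<beta> - \<alpha> + 3 * sqrt R)"
      by (rule mult_left_mono) (use inv uNq Nsq in auto)
    finally show "(b - a + 1 + u) * card S / (int N + u) \<le> card S * (\<beta> - \<alpha> + 3 * sqrt R)" .
  qed
  also have "\<dots> \<le> card S * (\<beta> - \<alpha> + 400 * sqrt R)"
    using mult_nonneg_nonneg[of "real (card S)" "sqrt R"] R0 by (simp add: algebra_simps)
  finally show ?thesis .
qed

section \<open>Arbitrary real intervals and the final estimate\<close>

text \<open>With the infimum and supremum as endpoints, the set lies between an open and a closed
  interval of equal measure. The closed one serves the upper bound, the open one the lower bound by
  complements.\<close>

lemma bounded_real_interval:
  fixes I :: "real set"
  assumes I: "is_interval I" "I \<subseteq> {c..d}" "I \<noteq> {}"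
  obtains \<alpha> \<beta> where "c \<le> \<alpha>" "\<alpha> \<le> \<beta>" "\<beta> \<le> d" "I \<subseteq> {\<alpha>..\<beta>}" "{\<alpha><..<\<beta>} \<subseteq> I"
    "measure lebesgue I = \<beta> - \<alpha>"
proof -
  define \<alpha> where "\<alpha> = Inf I"
  define \<beta> where "\<beta> = Sup I"
  have bd: "bdd_below I" "bdd_above I" using I(2) by (auto intro: bdd_below_mono bdd_above_mono)
  have sub: "I \<subseteq> {\<alpha>..\<beta>}"
    unfolding \<alpha>_def \<beta>_def using bd by (auto intro: cInf_lower cSup_upper)
  have inside: "{\<alpha><..<\<beta>} \<subseteq> I"
  proof
    fix x assume "x \<in> {\<alpha><..<\<beta>}"
    then have "\<exists>y\<in>I. y < x" "\<exists>z\<in>I. x < z"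
      unfolding \<alpha>_def \<beta>_def using bd I(3) by (auto simp: cInf_less_iff less_cSup_iff)
    then show "x \<in> I" using I(1) unfolding is_interval_1 by (meson less_imp_le)
  qed
  have \<alpha>\<beta>: "\<alpha> \<le> \<beta>" using sub I(3) by fastforce
  have cd: "c \<le> \<alpha>" "\<beta> \<le> d"
    unfolding \<alpha>_def \<beta>_def using I by (auto intro!: cInf_greatest cSup_least)
  have "bounded I" using I(2) bounded_subset bounded_closed_interval by blast
  then have meas: "I \<in> lmeasurable"
    using I(1) by (simp add: measurable_convex is_interval_convex)
  have "measure lebesgue I \<le> measure lebesgue {\<alpha>..\<beta>}"
    by (rule measure_mono_fmeasurable[OF sub]) (use meas in \<open>auto simp: fmeasurableD\<close>)
  moreover have "measure lebesgue {\<alpha><..<\<beta>} \<le> measure lebesgue I"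
    by (rule measure_mono_fmeasurable[OF inside _ meas]) auto
  ultimately have "measure lebesgue I = \<beta> - \<alpha>" using \<alpha>\<beta> by simp
  with that cd \<alpha>\<beta> sub inside show thesis by blast
qed

text \<open>The lower bound subtracts the upper bounds for [0, \<alpha>] and [\<beta>, 1] from |S|;
  two errors of \<open>400 * sqrt R\<close> give the constant 800.\<close>

lemma sidon_equidistributed:
  assumes N: "N > 0" and I: "is_interval I" "I \<subseteq> {0..1}" and S: "S \<subseteq> {1..int N}" and sid: "sidon S"
    and large: "real (card S) \<ge> 1 / 100 * sqrt (real N)"
    and R_def: "R = \<bar>real (card S) / sqrt (real N) - 1\<bar> + real N powr (- 1 / 6)"
  shows "\<bar>average S (\<lambda>x. indicator I (real_of_int x / real N)) - measure lebesgue I\<bar> \<le> 800 * sqrt R"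
proof (cases "I = {}")
  case True
  then show ?thesis by (simp add: average_def R_def)
next
  case False
  obtain \<alpha> \<beta> where ab: "0 \<le> \<alpha>" "\<alpha> \<le> \<beta>" "\<beta> \<le> 1" "I \<subseteq> {\<alpha>..\<beta>}" "{\<alpha><..<\<beta>} \<subseteq> I"
    and meas: "measure lebesgue I = \<beta> - \<alpha>"
    using bounded_real_interval[OF I False] by blast
  have finS: "finite S" using S finite_subset by blast
  have R0: "sqrt R \<ge> 0" unfolding R_def by simp
  have c0: "real (card S) > 0" using large N by (smt (verit) real_sqrt_gt_zero of_nat_0_less_iff mult_pos_pos divide_pos_pos)
  define T where "T = {s \<in> S. real_of_int s / real N \<in> I}"
  have "(\<Sum>x\<in>S. indicator I (real_of_int x / real N) :: real) = card T"
    unfolding T_def indicator_def using finS by (simp add: sum.If_cases Int_def)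
  then have avg: "average S (\<lambda>x. indicator I (real_of_int x / real N)) = card T / card S"
    unfolding average_def by simp
  note bound = sidon_real_interval_card_le[OF N S sid large _ _ _ R_def]
  have "card T \<le> card {s \<in> S. \<alpha> \<le> s / N \<and> s / N \<le> \<beta>}"
    unfolding T_def by (rule card_mono) (use finS ab(4) in auto)
  then have up: "card T \<le> card S * (\<beta> - \<alpha> + 400 * sqrt R)"
    using bound[of \<alpha> \<beta>] ab by linarith
  let ?L = "{s \<in> S. 0 \<le> s / N \<and> s / N \<le> \<alpha>}" and ?G = "{s \<in> S. \<beta> \<le> s / N \<and> s / N \<le> 1}"
  \<comment> \<open>Points at the endpoints may be counted twice, which is harmless: only a covering
    is needed.\<close>
  have "S \<subseteq> T \<union> (?L \<union> ?G)"
  proof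
    fix s assume s: "s \<in> S"
    then have "0 \<le> s / N" "s / N \<le> 1" using S N by auto
    then show "s \<in> T \<union> (?L \<union> ?G)"
      using s ab(5) unfolding T_def by (auto simp: subset_iff not_le)
  qed
  then have "card S \<le> card (T \<union> (?L \<union> ?G))"
    using finS by (intro card_mono) (auto simp: T_def)
  also have "\<dots> \<le> card T + (card ?L + card ?G)"
    by (meson card_Un_le add_left_mono order_trans)
  finally have "real (card S) \<le> card T + (real (card ?L) + card ?G)" by linarith
  also have "\<dots> \<le> card T + (card S * (\<alpha> - 0 + 400 * sqrt R) + card S * (1 - \<beta> + 400 * sqrt R))"
    using bound[of 0 \<alpha>] bound[of \<beta> 1] ab by (intro add_mono) auto
  finally have lo: "card S * (\<beta> - \<alpha> - 800 * sqrt R) \<le> card T"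
    by (simp add: algebra_simps)
  have "card T / card S \<le> \<beta> - \<alpha> + 400 * sqrt R"
    using up c0 by (simp add: pos_divide_le_eq mult.commute)
  moreover have "\<beta> - \<alpha> - 800 * sqrt R \<le> card T / card S"
    using lo c0 by (simp add: pos_le_divide_eq mult.commute)
  ultimately show ?thesis unfolding avg meas using R0 by linarith
qed

theorem corollary1p5:
  shows "\<forall>\<epsilon>::real. \<epsilon> > 0 \<longrightarrow>
    (\<exists>C::real. C > 0 \<and>
      (\<forall>(N::nat) (I::real set) (S::int set).
        N > 0 \<longrightarrow> is_interval I \<longrightarrow> I \<subseteq> {0..1} \<longrightarrow>
        S \<subseteq> {1..int N} \<longrightarrow> sidon S \<longrightarrow>
        real (card S) \<ge> 1 / 100 * real N powr (1 / 2) \<longrightarrow>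
        \<bar>average S (\<lambda>x. indicator I (real_of_int x / real N)) - measure lebesgue I\<bar>
          \<le> C * real N powr \<epsilon> *
             (\<bar>real (card S) / real N powr (1 / 2) - 1\<bar> + real N powr (- 1 / 6)) powr (1 / 2)))"
\<comment> \<open>The witness 800 is the absolute constant of \<open>sidon_equidistributed\<close>,
  independent of \<epsilon>.\<close>
proof (intro allI impI, rule exI[of _ 800], intro conjI allI impI)
  fix \<epsilon> :: real and N :: nat and I :: "real set" and S :: "int set"
  assume \<epsilon>: "\<epsilon> > 0" and N: "N > 0" and I: "is_interval I" "I \<subseteq> {0..1}"
    and S: "S \<subseteq> {1..int N}" "sidon S" "real (card S) \<ge> 1 / 100 * real N powr (1 / 2)"
  let ?R = "\<bar>real (card S) / real N powr (1 / 2) - 1\<bar> + real N powr (- 1 / 6)"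
  have "\<bar>average S (\<lambda>x. indicator I (real_of_int x / real N)) - measure lebesgue I\<bar> \<le> 800 * sqrt ?R"
    by (rule sidon_equidistributed) (use N I S in \<open>auto simp: powr_half_sqrt\<close>)
  also have "\<dots> = 800 * 1 * ?R powr (1 / 2)"
    by (simp add: powr_half_sqrt)
  also have "\<dots> \<le> 800 * real N powr \<epsilon> * ?R powr (1 / 2)"
    using N \<epsilon> by (intro mult_right_mono mult_left_mono) (auto simp: ge_one_powr_ge_zero)
  finally show "\<bar>average S (\<lambda>x. indicator I (real_of_int x / real N)) - measure lebesgue I\<bar>
      \<le> 800 * real N powr \<epsilon> * ?R powr (1 / 2)" .
qed simp

end
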